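(* For each integer $n\ge 3$, the space $\mathrm{Ind}_n$ is contractible, but the space $\mathrm{GST}_n$ is not contractible (both with the subspace topology from $\mathbb R^n$).
   Context: For $n\ge 2$ and $\mathbf p=(p_1,\dots,p_n)\in\mathbb R^n$ let $$\psi(\mathbf p)=\bigg(\frac{1}{2^{n-1}}\sum_{k=0}^{n-1}\binom{n-1}{k}p_{k+1}\bigg)^2-\frac{1}{2^{n-1}}\sum_{k=0}^{n-2}\binom{n-2}{k}\big(p_{k+2}^2+p_{k+1}p_{n-(k+1)}\big).$$ Put $\mathrm{Ind}_n=\{\mathbf p\in[0,1]^n:\psi(\mathbf p)=0\}$. For $x\in\{0,1\}^n$ and $1\le i\le n$ put $\pi_i(x)=p_k$ with $k=\#\{j: x_j=x_i\}$. $\mathrm{Inf}_n$ is the set of $\mathbf p\in[0,1]^n$ such that for all $1\le i,j\le n$ there is $x\in\{0,1\}^n$ with $\pi_i(x)\neq\pi_i(x')$, where $x'$ is $x$ with its $j$-th coordinate flipped. $\mathrm{GST}_n=\mathrm{Ind}_n\cap\mathrm{Inf}_n$. A space is contractible if its identity map is homotopic to a constant map. *)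

theory Defs
  imports "HOL-Analysis.Analysis"
begin

text \<open>
  A point of \<open>\<real>\<^sup>n\<close> is a function in \<open>{1..n} \<rightarrow>\<^sub>E UNIV\<close>, so that coordinates carry the
  indices \<open>1, \<dots>, n\<close>; the corresponding topological space is \<open>powertop_real {1..n}\<close>.
\<close>

definition psi :: "nat \<Rightarrow> (nat \<Rightarrow> real) \<Rightarrow> real" where
  "psi n p =
     (1 / 2 ^ (n - 1) * (\<Sum>k = 0..n - 1. real ((n - 1) choose k) * p (k + 1)))\<^sup>2
     - 1 / 2 ^ (n - 1) *
         (\<Sum>k = 0..n - 2. real ((n - 2) choose k) *
            ((p (k + 2))\<^sup>2 + p (k + 1) * p (n - (k + 1))))"

definition Ind :: "nat \<Rightarrow> (nat \<Rightarrow> real) set" where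
  "Ind n = {p \<in> {1..n} \<rightarrow>\<^sub>E {0..1}. psi n p = 0}"

definition pi_val :: "nat \<Rightarrow> (nat \<Rightarrow> real) \<Rightarrow> nat \<Rightarrow> (nat \<Rightarrow> nat) \<Rightarrow> real" where
  "pi_val n p i x = p (card {j \<in> {1..n}. x j = x i})"

definition Inf_set :: "nat \<Rightarrow> (nat \<Rightarrow> real) set" where
  "Inf_set n = {p \<in> {1..n} \<rightarrow>\<^sub>E {0..1}.
     \<forall>i \<in> {1..n}. \<forall>j \<in> {1..n}. \<exists>x \<in> {1..n} \<rightarrow>\<^sub>E {0, 1}.
       pi_val n p i x \<noteq> pi_val n p i (x(j := 1 - x j))}"

definition GST :: "nat \<Rightarrow> (nat \<Rightarrow> real) set" where
  "GST n = Ind n \<inter> Inf_set n"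

end

theory Submission
  imports Defs "HOL-Homology.Homology"
begin

text \<open>
  \<open>psi n\<close> is a quadratic form, so \<open>Ind n\<close> is star-shaped about \<open>0\<close>. It is also invariant under
  adding constants, and \<open>Inf_set n\<close> consists of the \<open>p\<close> that are not invariant under the reversal
  \<open>k \<mapsto> n + 1 - k\<close>. On vectors that are odd under the reversal \<open>psi n\<close> is negative definite.
  Hence the even part of a point of \<open>GST n\<close> is never constant: otherwise its odd part would be
  isotropic, so zero. Even vectors modulo constants form a space of dimension \<open>(n - 1) div 2\<close>,
  and the normalized even part maps \<open>GST n\<close> to its unit sphere.

  This map has a section. With weights \<open>w\<^sub>k = (n-1 choose k-1)\<close>, normalize an even \<open>s \<noteq> 0\<close> to
  weighted mean zero, let \<open>G\<^sub>j\<close> be the partial sums of \<open>w\<^sub>k s\<^sub>k\<close> and put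
  \<open>a\<^sub>j = (G\<^bsub>j-1\<^esub> + G\<^sub>j) / w\<^sub>j\<close>. Then \<open>a\<close> is odd, and \<open>psi n (s + a)\<close> is at least a positive
  multiple of \<open>\<Sum>j. G\<^sub>j\<^sup>2 / w\<^sub>j\<close>, hence positive. As \<open>psi n a < 0\<close>, the quadratic
  polynomial \<open>t \<mapsto> psi n (s + t a)\<close> has a root larger than \<open>1\<close>, which depends continuously on
  \<open>s\<close>. Rescaled into the cube, \<open>s + t a\<close> is a point of \<open>GST n\<close> with even part proportional to \<open>s\<close>
  up to constants. So a sphere is a retract of \<open>GST n\<close>, and spheres are not contractible.
\<close>

section \<open>The quadratic form and its polarization\<close>

definition wt :: "nat \<Rightarrow> nat \<Rightarrow> real" where
  "wt n k = real ((n - 1) choose (k - 1))"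

definition mean :: "nat \<Rightarrow> (nat \<Rightarrow> real) \<Rightarrow> real" where
  "mean n p = (\<Sum>k = 1..n. wt n k * p k) / 2 ^ (n - 1)"

definition cross :: "nat \<Rightarrow> (nat \<Rightarrow> real) \<Rightarrow> (nat \<Rightarrow> real) \<Rightarrow> real" where
  "cross n p q =
     (\<Sum>k = 0..n - 2. real ((n - 2) choose k) * (p (k + 2) * q (k + 2) + p (k + 1) * q (n - (k + 1))))
       / 2 ^ (n - 1)"

text \<open>Only the sum of the two mixed values \<open>psi_form n x y + psi_form n y x\<close>
  enters the later arguments, as the linear coefficient of \<open>psi\<close> along a line.\<close>

definition psi_form :: "nat \<Rightarrow> (nat \<Rightarrow> real) \<Rightarrow> (nat \<Rightarrow> real) \<Rightarrow> real" where
  "psi_form n p q = mean n p * mean n q - cross n p q"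

lemma wt_pos: "k \<in> {1..n} \<Longrightarrow> wt n k > 0"
  by (auto simp: wt_def)

lemma wt_rev: "k \<in> {1..n} \<Longrightarrow> wt n (n + 1 - k) = wt n k"
proof -
  assume "k \<in> {1..n}"
  then have "(n - 1) choose (k - 1) = (n - 1) choose (n - 1 - (k - 1))"
    by (intro binomial_symmetric) auto
  moreover have "n - 1 - (k - 1) = n + 1 - k - 1" using \<open>k \<in> {1..n}\<close> by auto
  ultimately show ?thesis by (simp add: wt_def)
qed

lemma sum_rev: "(\<Sum>k = 1..n. f (n + 1 - k)) = (\<Sum>k = 1..(n::nat). f k)"
  using sum.atLeastAtMost_rev[of f 1 n] by (simp add: add.commute)

lemma mean_eq:
  assumes "n \<ge> 1"
  shows "mean n p = 1 / 2 ^ (n - 1) * (\<Sum>k = 0..n - 1. real ((n - 1) choose k) * p (k + 1))"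
proof -
  have "(\<Sum>k = 1..n. wt n k * p k) = (\<Sum>k = 0..n - 1. wt n (k + 1) * p (k + 1))"
    using sum.shift_bounds_cl_nat_ivl[of "\<lambda>k. wt n k * p k" 0 1 "n - 1"] assms by simp
  then show ?thesis by (simp add: mean_def wt_def)
qed

lemma psi_eq_form: "n \<ge> 1 \<Longrightarrow> psi n p = psi_form n p p"
  by (simp add: psi_def psi_form_def mean_eq cross_def power2_eq_square)

lemma psi_form_add_left: "psi_form n (\<lambda>k. x k + y k) z = psi_form n x z + psi_form n y z"
  by (simp add: psi_form_def mean_def cross_def algebra_simps sum.distrib add_divide_distrib)

lemma psi_form_add_right: "psi_form n z (\<lambda>k. x k + y k) = psi_form n z x + psi_form n z y"
  by (simp add: psi_form_def mean_def cross_def algebra_simps sum.distrib add_divide_distrib)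

lemma mean_scale: "mean n (\<lambda>k. c * x k) = c * mean n x"
  by (simp add: mean_def sum_distrib_left algebra_simps)

lemma psi_form_scale_left: "psi_form n (\<lambda>k. c * x k) z = c * psi_form n x z"
  by (simp add: psi_form_def mean_scale cross_def algebra_simps sum_distrib_left)

lemma psi_form_scale_right: "psi_form n z (\<lambda>k. c * x k) = c * psi_form n z x"
  by (simp add: psi_form_def mean_scale cross_def algebra_simps sum_distrib_left)

lemma psi_pencil:
  assumes "n \<ge> 1"
  shows "psi n (\<lambda>k. x k + t * y k) =
           psi n x + t * (psi_form n x y + psi_form n y x) + t\<^sup>2 * psi n y"
  by (simp add: psi_eq_form[OF assms] psi_form_add_left psi_form_add_right psi_form_scale_left
      psi_form_scale_right algebra_simps power2_eq_square)

lemma psi_scale: "n \<ge> 1 \<Longrightarrow> psi n (\<lambda>k. t * x k) = t\<^sup>2 * psi n x"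
  by (simp add: psi_eq_form psi_form_scale_left psi_form_scale_right power2_eq_square)

lemma psi_cong:
  assumes "n \<ge> 2" "\<And>k. k \<in> {1..n} \<Longrightarrow> p k = q k"
  shows "psi n p = psi n q"
proof -
  have "(\<Sum>k = 0..n - 1. real ((n - 1) choose k) * p (k + 1)) =
        (\<Sum>k = 0..n - 1. real ((n - 1) choose k) * q (k + 1))"
    using assms by (intro sum.cong) auto
  moreover have "(\<Sum>k = 0..n - 2. real ((n - 2) choose k) * ((p (k + 2))\<^sup>2 + p (k + 1) * p (n - (k + 1)))) =
     (\<Sum>k = 0..n - 2. real ((n - 2) choose k) * ((q (k + 2))\<^sup>2 + q (k + 1) * q (n - (k + 1))))"
    using assms by (intro sum.cong) auto
  ultimately show ?thesis unfolding psi_def by metis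
qed

section \<open>Invariance under adding constants\<close>

text \<open>Pascal's rule, summed. It brings the weights of the mean to the level
  \<open>n - 2\<close> at which \<open>cross\<close> is written.\<close>

lemma sum_choose_Suc:
  fixes f :: "nat \<Rightarrow> real"
  shows "(\<Sum>k = 0..Suc m. real (Suc m choose k) * f k) =
         (\<Sum>k = 0..m. real (m choose k) * (f k + f (k + 1)))"
proof -
  have "(\<Sum>k = 0..Suc m. real (Suc m choose k) * f k) =
      f 0 + (\<Sum>k = 0..m. real (Suc m choose Suc k) * f (Suc k))"
    by (subst sum.atLeast0_atMost_Suc_shift) simp
  also have "\<dots> = (\<Sum>k = 0..m. real (m choose k) * f (Suc k)) +
      (f 0 + (\<Sum>k = 0..m. real (m choose Suc k) * f (Suc k)))"
    by (simp add: algebra_simps sum.distrib)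
  also have "f 0 + (\<Sum>k = 0..m. real (m choose Suc k) * f (Suc k)) =
      (\<Sum>k = 0..Suc m. real (m choose k) * f k)"
    by (subst sum.atLeast0_atMost_Suc_shift) simp
  also have "\<dots> = (\<Sum>k = 0..m. real (m choose k) * f k)"
    by simp
  finally show ?thesis by (simp add: algebra_simps sum.distrib)
qed

lemma sum_choose_rev:
  fixes f :: "nat \<Rightarrow> real"
  shows "(\<Sum>k = 0..m. real (m choose k) * f (m - k)) = (\<Sum>k = 0..m. real (m choose k) * f k)"
proof -
  have "(\<Sum>k = 0..m. real (m choose k) * f k) = (\<Sum>k = 0..m. real (m choose (m - k)) * f (m - k))"
    using sum.atLeastAtMost_rev[of "\<lambda>k. real (m choose k) * f k" 0 m] by simp
  also have "\<dots> = (\<Sum>k = 0..m. real (m choose k) * f (m - k))"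
    by (intro sum.cong) (auto simp: binomial_symmetric[symmetric])
  finally show ?thesis by simp
qed

lemma mean_one: "n \<ge> 1 \<Longrightarrow> mean n (\<lambda>_. 1) = 1"
  using choose_row_sum[of "n - 1"]
  by (simp add: mean_eq atLeast0AtMost flip: of_nat_sum)

text \<open>Pascal's rule and the reflection of \<open>k\<close> give \<open>2 * mean n x\<close>
  and the sum of the two cross terms the same value.\<close>

lemma psi_form_const:
  assumes "n \<ge> 2"
  shows "psi_form n (\<lambda>_. 1) x + psi_form n x (\<lambda>_. 1) = 0"
proof -
  define m where "m = n - 2"
  have n: "n = Suc (Suc m)" using assms by (simp add: m_def)
  have rev: "(\<Sum>k = 0..m. real (m choose k) * x (n - (k + 1))) =
      (\<Sum>k = 0..m. real (m choose k) * x (k + 1))"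
    unfolding sum_choose_rev[of m "\<lambda>k. x (k + 1)", symmetric]
    by (intro sum.cong) (auto simp: n Suc_diff_le)
  have "mean n x = (\<Sum>k = 0..m. real (m choose k) * (x (k + 1) + x (k + 2))) / 2 ^ (n - 1)"
    using sum_choose_Suc[of m "\<lambda>k. x (k + 1)"] assms by (simp add: mean_eq n)
  moreover have "cross n (\<lambda>_. 1) x + cross n x (\<lambda>_. 1) =
     2 * (\<Sum>k = 0..m. real (m choose k) * (x (k + 1) + x (k + 2))) / 2 ^ (n - 1)"
    using rev by (simp add: cross_def n algebra_simps sum.distrib flip: add_divide_distrib)
  ultimately show ?thesis
    using assms by (simp add: psi_form_def mean_one)
qed

text \<open>Constants are isotropic and have no mixed term with \<open>x\<close>, so only the
  quadratic coefficient survives. This lets zeros of \<open>psi\<close> be moved into the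
  cube.\<close>

lemma psi_affine:
  assumes "n \<ge> 2"
  shows "psi n (\<lambda>k. c + t * x k) = t\<^sup>2 * psi n x"
proof -
  have "psi n (\<lambda>_. c) = c\<^sup>2 * psi n (\<lambda>_. 1)"
    using psi_scale[of n c "\<lambda>_. 1"] assms by simp
  then have 0: "psi n (\<lambda>_. c) = 0"
    using psi_form_const[OF assms, of "\<lambda>_. 1"] assms by (simp add: psi_eq_form)
  have "psi_form n (\<lambda>_. c) x = c * psi_form n (\<lambda>_. 1) x" "psi_form n x (\<lambda>_. c) = c * psi_form n x (\<lambda>_. 1)"
    using psi_form_scale_left[of n c "\<lambda>_. 1" x] psi_form_scale_right[of n x c "\<lambda>_. 1"] by auto
  then have "psi_form n (\<lambda>_. c) x + psi_form n x (\<lambda>_. c) = 0"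
    using psi_form_const[OF assms, of x] by (simp flip: distrib_left)
  with 0 psi_pencil[of n "\<lambda>_. c" t x] assms show ?thesis by simp
qed

section \<open>Negative definiteness on odd vectors\<close>

text \<open>Even weights kill the mean. Oddness turns the product in \<open>psi\<close> into
  \<open>- a (k + 1) * a (k + 2)\<close>, and by reflection the squares at \<open>k + 1\<close> and
  at \<open>k + 2\<close> have equal sums, which completes the square at the cost of a factor
  2.\<close>

lemma psi_antisym:
  assumes "n \<ge> 2" and anti: "\<And>k. k \<in> {1..n} \<Longrightarrow> a (n + 1 - k) = - a k"
  shows "psi n a = - (\<Sum>k = 0..n - 2. real ((n - 2) choose k) * (a (k + 2) - a (k + 1))\<^sup>2) / 2 ^ n"
proof -
  define m where "m = n - 2"
  have n: "n = Suc (Suc m)" using assms by (simp add: m_def)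
  have "(\<Sum>k = 1..n. wt n k * a k) = (\<Sum>k = 1..n. wt n (n + 1 - k) * a (n + 1 - k))"
    by (rule sum_rev[symmetric])
  also have "\<dots> = (\<Sum>k = 1..n. - (wt n k * a k))"
    by (intro sum.cong) (auto simp: wt_rev anti simp del: One_nat_def)
  finally have mean0: "mean n a = 0"
    by (simp add: mean_def sum_negf)
  have anti': "a (n - (k + 1)) = - a (k + 2)" if "k \<le> m" for k
    using anti[of "k + 2"] that by (simp add: n)
  have "(\<Sum>k = 0..m. real (m choose k) * (a (k + 2))\<^sup>2) =
        (\<Sum>k = 0..m. real (m choose k) * (a (m - k + 2))\<^sup>2)"
    using sum_choose_rev[of m "\<lambda>k. (a (k + 2))\<^sup>2"] by simp
  also have "\<dots> = (\<Sum>k = 0..m. real (m choose k) * (a (k + 1))\<^sup>2)"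
  proof (intro sum.cong refl)
    fix k assume "k \<in> {0..m}"
    then have "a (m - k + 2) = - a (k + 1)"
      using anti[of "k + 1"] by (simp add: n Suc_diff_le)
    then show "real (m choose k) * (a (m - k + 2))\<^sup>2 = real (m choose k) * (a (k + 1))\<^sup>2" by simp
  qed
  finally have eq: "(\<Sum>k = 0..m. real (m choose k) * (a (k + 2))\<^sup>2) =
      (\<Sum>k = 0..m. real (m choose k) * (a (k + 1))\<^sup>2)" .
  have "cross n a a * 2 ^ (n - 1) =
      (\<Sum>k = 0..m. real (m choose k) * ((a (k + 2))\<^sup>2 - a (k + 1) * a (k + 2)))"
    by (simp add: cross_def n) (rule sum.cong, use anti' in \<open>auto simp: n power2_eq_square\<close>)
  also have "\<dots> = (\<Sum>k = 0..m. real (m choose k) * (a (k + 2))\<^sup>2) -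
      (\<Sum>k = 0..m. real (m choose k) * (a (k + 1) * a (k + 2)))"
    by (simp add: right_diff_distrib sum_subtractf)
  finally have c: "cross n a a * 2 ^ (n - 1) = \<dots>" .
  have "(\<Sum>k = 0..m. real (m choose k) * (a (k + 2) - a (k + 1))\<^sup>2) =
      (\<Sum>k = 0..m. real (m choose k) * (a (k + 2))\<^sup>2) +
      (\<Sum>k = 0..m. real (m choose k) * (a (k + 1))\<^sup>2) -
      2 * (\<Sum>k = 0..m. real (m choose k) * (a (k + 1) * a (k + 2)))"
    by (simp add: power2_diff algebra_simps sum.distrib sum_subtractf sum_distrib_left)
  with c eq have "2 * (cross n a a * 2 ^ (n - 1)) =
      (\<Sum>k = 0..m. real (m choose k) * (a (k + 2) - a (k + 1))\<^sup>2)"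
    by linarith
  then have "cross n a a = (\<Sum>k = 0..m. real (m choose k) * (a (k + 2) - a (k + 1))\<^sup>2) / 2 ^ n"
    by (simp add: n field_simps)
  then show ?thesis
    using assms mean0 by (simp add: psi_eq_form psi_form_def m_def)
qed

text \<open>A vanishing sum of squares makes all entries agree, and a constant odd vector is zero
  because its first and last entries are opposite.\<close>

lemma psi_antisym_neg:
  assumes "n \<ge> 2" and anti: "\<And>k. k \<in> {1..n} \<Longrightarrow> a (n + 1 - k) = - a k"
    and "j \<in> {1..n}" "a j \<noteq> 0"
  shows "psi n a < 0"
proof (rule ccontr)
  assume "\<not> psi n a < 0"
  then have "(\<Sum>k = 0..n - 2. real ((n - 2) choose k) * (a (k + 2) - a (k + 1))\<^sup>2) \<le> 0"
    using psi_antisym[of n a] assms(1) anti by (simp add: not_less divide_le_0_iff power_le_zero_eq)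
  moreover have "(\<Sum>k = 0..n - 2. real ((n - 2) choose k) * (a (k + 2) - a (k + 1))\<^sup>2) \<ge> 0"
    by (intro sum_nonneg) auto
  ultimately have "(\<Sum>k = 0..n - 2. real ((n - 2) choose k) * (a (k + 2) - a (k + 1))\<^sup>2) = 0"
    by simp
  then have "\<forall>k\<in>{0..n - 2}. real ((n - 2) choose k) * (a (k + 2) - a (k + 1))\<^sup>2 = 0"
    by (subst (asm) sum_nonneg_eq_0_iff) auto
  then have step: "a (k + 2) = a (k + 1)" if "k \<le> n - 2" for k
    using that by auto
  have const: "a (Suc k) = a 1" if "k < n" for k
    using that
  proof (induction k)
    case (Suc k)
    then have "a (Suc (Suc k)) = a (Suc k)" using step[of k] assms(1) by simp
    with Suc show ?case by simp
  qed simp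
  have "a j = a 1" using const[of "j - 1"] assms by auto
  moreover have "a n = a 1" using const[of "n - 1"] assms by auto
  moreover have "a n = - a 1" using anti[of 1] assms by simp
  ultimately show False using assms by simp
qed

section \<open>The odd companion of an even vector\<close>

definition partial :: "nat \<Rightarrow> (nat \<Rightarrow> real) \<Rightarrow> nat \<Rightarrow> real" where
  "partial n s j = (\<Sum>k = 1..j. wt n k * s k)"

text \<open>
  This choice makes \<open>s + odd_part n s\<close> equal to twice the partial sums divided by the weights. As
  \<open>partial n s (n - j) = - partial n s j\<close>, even the mixed products in \<open>psi\<close> become multiples of
  squares of partial sums.
\<close>

definition odd_part :: "nat \<Rightarrow> (nat \<Rightarrow> real) \<Rightarrow> nat \<Rightarrow> real" where
  "odd_part n s j = (partial n s (j - 1) + partial n s j) / wt n j"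

lemma partial_step: "j \<ge> 1 \<Longrightarrow> partial n s j = partial n s (j - 1) + wt n j * s j"
  by (cases j) (auto simp: partial_def)

text \<open>The total is zero, so the first \<open>n - j\<close> terms sum to minus the last
  \<open>j\<close>, and by reversal these have the same sum as the first \<open>j\<close>.\<close>

lemma partial_rev:
  assumes sym: "\<And>k. k \<in> {1..n} \<Longrightarrow> s (n + 1 - k) = s k" and "mean n s = 0" and "j \<le> n"
  shows "partial n s (n - j) = - partial n s j"
  using \<open>j \<le> n\<close>
proof (induction j)
  case 0
  then show ?case using assms by (simp add: partial_def mean_def)
next
  case (Suc j)
  have "partial n s (n - j) = partial n s (n - Suc j) + wt n (n + 1 - Suc j) * s (n + 1 - Suc j)"
    using partial_step[of "n - j" n s] Suc by simp
  then have "partial n s (n - j) = partial n s (n - Suc j) + wt n (Suc j) * s (Suc j)"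
    using sym[of "Suc j"] wt_rev[of "Suc j" n] Suc by auto
  moreover have "partial n s (Suc j) = partial n s j + wt n (Suc j) * s (Suc j)"
    using partial_step[of "Suc j" n s] by simp
  ultimately show ?case using Suc by simp
qed

lemma odd_part_antisym:
  assumes "\<And>k. k \<in> {1..n} \<Longrightarrow> s (n + 1 - k) = s k" and "mean n s = 0" and "j \<in> {1..n}"
  shows "odd_part n s (n + 1 - j) = - odd_part n s j"
proof -
  have j: "n + 1 - j - 1 = n - j" "n + 1 - j = n - (j - 1)" "j - 1 \<le> n" "j \<le> n"
    using assms(3) by auto
  have "partial n s (n - (j - 1)) = - partial n s (j - 1)" "partial n s (n - j) = - partial n s j"
    using partial_rev[of n s] assms(1,2) j(3,4) by blast+
  then have "odd_part n s (n + 1 - j) = (- partial n s j - partial n s (j - 1)) / wt n j"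
    unfolding odd_part_def wt_rev[OF assms(3)] j(1) by (simp only: j(2) diff_conv_add_uminus)
  then show ?thesis
    by (simp add: odd_part_def add_divide_distrib diff_divide_distrib)
qed

lemma even_plus_odd:
  "j \<in> {1..n} \<Longrightarrow> s j + odd_part n s j = 2 * partial n s j / wt n j"
  using wt_pos[of j n] partial_step[of j n s] by (auto simp: odd_part_def field_simps)

lemma zero_if_partial_zero:
  assumes "\<And>j. j \<in> {1..n} \<Longrightarrow> partial n s j = 0" "k \<in> {1..n}"
  shows "s k = 0"
proof -
  have "k - 1 = 0 \<or> k - 1 \<in> {1..n}" using assms(2) by auto
  then have "partial n s (k - 1) = 0" using assms(1) by (elim disjE) (simp_all add: partial_def)
  then have "wt n k * s k = 0" using partial_step[of k n s] assms by auto
  then show ?thesis using wt_pos[OF assms(2)] by simp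
qed

text \<open>If the odd part vanishes, each partial sum is minus its predecessor; starting from the
  empty sum all of them vanish, and so do their increments.\<close>

lemma odd_part_nonzero:
  assumes "k \<in> {1..n}" "s k \<noteq> 0"
  shows "\<exists>j\<in>{1..n}. odd_part n s j \<noteq> 0"
proof (rule ccontr)
  assume *: "\<not> ?thesis"
  have "partial n s j = 0" if "j \<le> n" for j
    using that
  proof (induction j)
    case (Suc j)
    then have "odd_part n s (Suc j) = 0" using * by auto
    then show ?case using Suc wt_pos[of "Suc j" n] by (simp add: odd_part_def)
  qed (simp add: partial_def)
  then show False using zero_if_partial_zero[of n s k] assms by auto
qed

text \<open>With \<open>p k = 2 * G k / wt n k\<close> the cross sum is a difference of two weighted
  sums of the nonnegative \<open>F\<close>, whose coefficients differ by \<open>1 / (m + 1)\<close>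
  after an index shift. So \<open>cross\<close> is negative, while the squared mean is
  nonnegative.\<close>

lemma psi_even_plus_odd_pos:
  assumes n2: "n \<ge> 2" and sym: "\<And>k. k \<in> {1..n} \<Longrightarrow> s (n + 1 - k) = s k" and mean: "mean n s = 0"
    and nz: "i \<in> {1..n}" "s i \<noteq> 0"
  shows "psi n (\<lambda>k. s k + odd_part n s k) > 0"
proof -
  define m where "m = n - 2"
  have n: "n = Suc (Suc m)" using n2 by (simp add: m_def)
  define G where "G = partial n s"
  define p where "p = (\<lambda>k. s k + odd_part n s k)"
  define F where "F = (\<lambda>j. 4 * (G j)\<^sup>2 / wt n j)"
  have p: "p j = 2 * G j / wt n j" if "j \<in> {1..n}" for j
    using even_plus_odd[OF that] by (simp add: p_def G_def)
  have Gn: "G n = 0" using partial_rev[OF sym mean, of 0] by (simp add: G_def partial_def)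
  \<comment> \<open>Absorption identity; the factor \<open>wt n (k + 2)\<close> cancels a
    denominator in both kinds of products below.\<close>
  have c: "real (m choose k) = real (k + 1) / real (m + 1) * wt n (k + 2)" for k
  proof -
    have "real (Suc k * (Suc m choose Suc k)) = real (Suc m * (m choose k))"
      by (simp only: Suc_times_binomial)
    then show ?thesis
      by (simp add: wt_def n field_simps del: binomial_Suc_Suc)
  qed
  have sq: "real (m choose k) * (p (k + 2))\<^sup>2 = real (k + 1) / real (m + 1) * F (k + 2)" if "k \<le> m" for k
  proof -
    have w: "wt n (k + 2) > 0" using that by (intro wt_pos) (auto simp: n)
    have p2: "p (k + 2) = 2 * G (k + 2) / wt n (k + 2)" using that by (intro p) (auto simp: n)
    have cancel: "r * w * (2 * g / w)\<^sup>2 = r * (4 * g\<^sup>2 / w)" if "w > 0" for r g w :: real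
      using that by (simp add: field_simps power2_eq_square)
    show ?thesis
      unfolding c F_def p2 by (rule cancel[OF w])
  qed
  \<comment> \<open>\<open>n - (k + 1)\<close> mirrors \<open>k + 2\<close>, so its weight is
    \<open>wt n (k + 2)\<close>, while its partial sum is \<open>- G (k + 1)\<close>: the mixed
    product becomes minus a square.\<close>
  have pr: "real (m choose k) * (p (k + 1) * p (n - (k + 1))) = - (real (k + 1) / real (m + 1)) * F (k + 1)"
    if "k \<le> m" for k
  proof -
    have w2: "wt n (k + 2) > 0" and w1: "wt n (k + 1) > 0" using that by (auto intro!: wt_pos simp: n)
    have wr: "wt n (n - (k + 1)) = wt n (k + 2)" using wt_rev[of "k + 2" n] that by (simp add: n)
    have "G (n - (k + 1)) = - G (k + 1)"
      using partial_rev[OF sym mean, of "k + 1"] that by (simp add: G_def n)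
    moreover have "n - (k + 1) \<in> {1..n}" using that by (auto simp: n)
    ultimately have p2: "p (n - (k + 1)) = - 2 * G (k + 1) / wt n (k + 2)"
      using p[of "n - (k + 1)"] by (simp only: wr)
    have p1: "p (k + 1) = 2 * G (k + 1) / wt n (k + 1)"
      using that by (intro p) (auto simp: n)
    have cancel: "r * w * (2 * g / v * (- 2 * g / w)) = - r * (4 * g\<^sup>2 / v)" if "v > 0" "w > 0" for r g v w :: real
      using that by (simp add: field_simps power2_eq_square)
    show ?thesis
      unfolding c p1 p2 F_def by (rule cancel[OF w1 w2])
  qed
  have "cross n p p * 2 ^ (n - 1) =
      (\<Sum>k = 0..m. real (m choose k) * ((p (k + 2))\<^sup>2 + p (k + 1) * p (n - (k + 1))))"
    by (simp add: cross_def n power2_eq_square)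
  also have "\<dots> =
      (\<Sum>k = 0..m. real (m choose k) * (p (k + 2))\<^sup>2) + (\<Sum>k = 0..m. real (m choose k) * (p (k + 1) * p (n - (k + 1))))"
    by (simp only: distrib_left sum.distrib)
  also have "\<dots> = (\<Sum>k = 0..m. real (k + 1) / real (m + 1) * F (k + 2)) -
      (\<Sum>k = 0..m. real (k + 1) / real (m + 1) * F (k + 1))"
    unfolding sum_negf[symmetric] diff_conv_add_uminus
    by (intro arg_cong2[where f = "(+)"] sum.cong refl) (simp_all only: sq pr atLeastAtMost_iff minus_mult_left)
  \<comment> \<open>The boundary terms of the shift vanish: the coefficient is 0 at
    \<open>k = 0\<close>, and \<open>F n = 0\<close> since the total sum is zero.\<close>
  also have "(\<Sum>k = 0..m. real (k + 1) / real (m + 1) * F (k + 2)) =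
      (\<Sum>k = 0..m. real k / real (m + 1) * F (k + 1))"
    using sum.atLeast0_atMost_Suc_shift[of "\<lambda>k. real k / real (m + 1) * F (k + 1)" m] Gn
    by (simp add: F_def n)
  also have "\<dots> - (\<Sum>k = 0..m. real (k + 1) / real (m + 1) * F (k + 1)) =
      (\<Sum>k = 0..m. - F (k + 1) / real (m + 1))"
    unfolding sum_subtractf[symmetric]
    by (intro sum.cong refl) (simp add: divide_simps, simp add: algebra_simps)
  finally have "cross n p p * 2 ^ (n - 1) = - (\<Sum>k = 0..m. F (k + 1)) / real (m + 1)"
    by (simp only: sum_divide_distrib[symmetric] sum_negf)
  moreover have "(\<Sum>k = 0..m. F (k + 1)) > 0"
  proof -
    obtain j where j: "j \<in> {1..n}" "G j \<noteq> 0"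
      using zero_if_partial_zero[of n s i] nz by (auto simp: G_def)
    then have "j \<noteq> n" using Gn by auto
    have "0 < F (j - 1 + 1)" using j wt_pos[of j n] by (simp add: F_def)
    moreover have "F (k + 1) \<ge> 0" if "k \<in> {0..m}" for k
      using wt_pos[of "k + 1" n] that by (simp add: F_def n)
    ultimately show ?thesis
      using j \<open>j \<noteq> n\<close> by (intro sum_pos2[where i = "j - 1"]) (auto simp: n)
  qed
  ultimately have "cross n p p * 2 ^ (n - 1) < 0"
    by (simp add: divide_neg_pos)
  then have "cross n p p < 0" by (simp add: mult_less_0_iff)
  also have "0 \<le> mean n p * mean n p" by simp
  finally show ?thesis
    unfolding p_def[symmetric] using n2 by (simp add: psi_eq_form psi_form_def)
qed

text \<open>The polynomial \<open>C + t * B - t^2 * A\<close> is positive at 1 and has negative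
  leading coefficient, so its larger root even exceeds 1. The closed formula makes continuous
  dependence evident.\<close>

lemma larger_root:
  fixes A B C :: real
  assumes "A > 0" "A < B + C"
  defines "t \<equiv> (B + sqrt (B\<^sup>2 + 4 * A * C)) / (2 * A)"
  shows "t > 0" "C + t * B - t\<^sup>2 * A = 0"
proof -
  have "A * (A - B) < A * C" using assms(1,2) by (intro mult_strict_left_mono) auto
  then have d: "(2 * A - B)\<^sup>2 < B\<^sup>2 + 4 * A * C"
    by (simp add: power2_eq_square algebra_simps)
  then have "\<bar>2 * A - B\<bar> < sqrt (B\<^sup>2 + 4 * A * C)"
    by (metis real_sqrt_abs real_sqrt_less_iff)
  then show "t > 0" using assms(1) by (simp add: t_def)
  have "B\<^sup>2 + 4 * A * C \<ge> 0" using d zero_le_power2[of "2 * A - B"] by linarith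
  then have "(2 * A * t - B)\<^sup>2 = B\<^sup>2 + 4 * A * C" using assms(1) by (simp add: t_def)
  then have "4 * A * (C + t * B - t\<^sup>2 * A) = 0"
    by (simp add: power2_eq_square algebra_simps)
  then show "C + t * B - t\<^sup>2 * A = 0" using assms(1) by simp
qed

lemma psi_restrict: "n \<ge> 2 \<Longrightarrow> psi n (restrict p {1..n}) = psi n p"
  by (rule psi_cong) auto

lemma continuous_map_into_powertop_real_subset:
  assumes "\<And>k. k \<in> I \<Longrightarrow> continuous_map X euclideanreal (\<lambda>x. f x k)"
    and "\<And>x. x \<in> topspace X \<Longrightarrow> restrict (f x) I \<in> S"
  shows "continuous_map X (subtopology (powertop_real I) S) (\<lambda>x. restrict (f x) I)"
  using assms by (auto simp: continuous_map_in_subtopology continuous_map_componentwise)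

section \<open>Contractibility of \<open>Ind n\<close>\<close>

lemma contractible_space_Ind:
  assumes "n \<ge> 2"
  shows "contractible_space (subtopology (powertop_real {1..n}) (Ind n))"
proof -
  let ?X = "subtopology (powertop_real {1..n}) (Ind n)"
  let ?T = "prod_topology (top_of_set {0..1::real}) ?X"
  let ?h = "\<lambda>z. restrict (\<lambda>i. (1 - fst z) * snd z i) {1..n}"
  have "continuous_map ?T ?X ?h"
  proof (rule continuous_map_into_powertop_real_subset)
    fix k assume k: "k \<in> {1..n}"
    have "continuous_map ?T euclideanreal fst"
      using continuous_map_fst continuous_map_into_fulltopology by blast
    moreover have "continuous_map ?T euclideanreal ((\<lambda>p. p k) \<circ> snd)"
      by (rule continuous_map_compose[OF continuous_map_snd])
        (intro continuous_map_from_subtopology continuous_map_product_projection k)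
    ultimately show "continuous_map ?T euclideanreal (\<lambda>z. (1 - fst z) * snd z k)"
      unfolding comp_def by (intro continuous_intros)
  next
    fix z assume "z \<in> topspace ?T"
    then have t: "0 \<le> fst z" "fst z \<le> 1" and p: "snd z \<in> {1..n} \<rightarrow>\<^sub>E {0..1}" "psi n (snd z) = 0"
      by (auto simp: Ind_def)
    have "(1 - fst z) * snd z i \<in> {0..1}" if "i \<in> {1..n}" for i
    proof -
      have "0 \<le> snd z i" "snd z i \<le> 1" using PiE_mem[OF p(1) that] by auto
      with t show ?thesis by (simp add: mult_le_one)
    qed
    then have "?h z \<in> {1..n} \<rightarrow>\<^sub>E {0..1}" by auto
    moreover have "psi n (?h z) = (1 - fst z)\<^sup>2 * psi n (snd z)"
      unfolding psi_restrict[OF assms] using assms by (intro psi_scale) simp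
    ultimately show "?h z \<in> Ind n"
      using p by (simp add: Ind_def)
  qed
  moreover have "\<forall>p \<in> topspace ?X. ?h (0, p) = id p"
    by (auto simp: Ind_def PiE_def extensional_restrict)
  ultimately have "homotopic_with (\<lambda>x. True) ?X ?X id (\<lambda>_. restrict (\<lambda>_. 0) {1..n})"
    by (subst homotopic_with) (auto intro!: exI[where x = ?h])
  then show ?thesis
    unfolding contractible_space_def by blast
qed

section \<open>The influence condition as asymmetry under reversal\<close>

text \<open>Flipping the coordinate of \<open>i\<close> itself turns a class of size
  \<open>k\<close> into one of size \<open>n + 1 - k\<close>; flipping another coordinate changes
  the size by one. The first case is the asymmetry, and it implies the nonconstancy demanded by the
  second.\<close>

lemma Inf_set_iff:
  assumes "n \<ge> 2"
  shows "p \<in> Inf_set n \<longleftrightarrow> p \<in> {1..n} \<rightarrow>\<^sub>E {0..1} \<and> (\<exists>k\<in>{1..n}. p (n + 1 - k) \<noteq> p k)"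
proof (intro iffI conjI)
  assume p: "p \<in> Inf_set n"
  then show "p \<in> {1..n} \<rightarrow>\<^sub>E {0..1}" by (simp add: Inf_set_def)
  have "1 \<in> {1..n}" using assms by simp
  with p obtain x where x: "x \<in> {1..n} \<rightarrow>\<^sub>E {0, 1}"
    and ne: "pi_val n p 1 x \<noteq> pi_val n p 1 (x(1 := 1 - x 1))"
    unfolding Inf_set_def by blast
  define A where "A = {j \<in> {1..n}. x j = x 1}"
  have x01: "x j = 0 \<or> x j = 1" if "j \<in> {1..n}" for j
    using PiE_mem[OF x that] by auto
  have A: "A \<subseteq> {1..n}" "1 \<in> A" using assms by (auto simp: A_def)
  then have fin: "finite A" using finite_subset by blast
  have "{j \<in> {1..n}. (x(1 := 1 - x 1)) j = (x(1 := 1 - x 1)) 1} = insert 1 ({1..n} - A)"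
  proof (rule Set.set_eqI)
    fix j
    show "j \<in> {j \<in> {1..n}. (x(1 := 1 - x 1)) j = (x(1 := 1 - x 1)) 1} \<longleftrightarrow> j \<in> insert 1 ({1..n} - A)"
      using x01[of j] x01[of 1] assms by (cases "j = 1") (auto simp: A_def)
  qed
  moreover have "card (insert 1 ({1..n} - A)) = n + 1 - card A"
    using A fin card_mono[OF _ A(1)] by (simp add: card_Diff_subset Suc_diff_le)
  ultimately have "p (n + 1 - card A) \<noteq> p (card A)"
    using ne by (auto simp: pi_val_def A_def)
  moreover have "card A \<in> {1..n}"
    using card_mono[OF _ A(1)] A fin card_gt_0_iff[of A] by (auto simp: Suc_le_eq)
  ultimately show "\<exists>k\<in>{1..n}. p (n + 1 - k) \<noteq> p k" by blast
next
  assume "p \<in> {1..n} \<rightarrow>\<^sub>E {0..1} \<and> (\<exists>k\<in>{1..n}. p (n + 1 - k) \<noteq> p k)"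
  then obtain k where p: "p \<in> {1..n} \<rightarrow>\<^sub>E {0..1}" and k: "k \<in> {1..n}" "p (n + 1 - k) \<noteq> p k"
    by blast
  let ?x = "\<lambda>S. restrict (\<lambda>l. if l \<in> S then 1 else 0 :: nat) {1..n}"
  have "\<exists>x \<in> {1..n} \<rightarrow>\<^sub>E {0, 1}. pi_val n p i x \<noteq> pi_val n p i (x(j := 1 - x j))"
    if i: "i \<in> {1..n}" and j: "j \<in> {1..n}" for i j
  proof (cases "i = j")
    case True
    have "k - 1 \<le> card ({1..n} - {i})" using k i by (simp add: diff_le_mono)
    then obtain T where T: "T \<subseteq> {1..n} - {i}" "card T = k - 1" "finite T"
      by (metis obtain_subset_with_card_n)
    define S where "S = insert i T"
    have S: "S \<subseteq> {1..n}" "i \<in> S" "finite S" "card S = k"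
      using T i k by (auto simp: S_def card_insert_if)
    have "{l \<in> {1..n}. ?x S l = ?x S i} = S"
      using S by auto
    moreover have "{l \<in> {1..n}. ((?x S)(i := 1 - ?x S i)) l = ((?x S)(i := 1 - ?x S i)) i} =
        insert i ({1..n} - S)"
      using S by auto
    moreover have "card (insert i ({1..n} - S)) = n + 1 - k"
      using S k by (simp add: card_Diff_subset Suc_diff_le)
    ultimately have "pi_val n p i (?x S) \<noteq> pi_val n p i ((?x S)(j := 1 - ?x S j))"
      using k S True by (simp add: pi_val_def)
    then show ?thesis by (intro bexI[of _ "?x S"]) auto
  next
    case False
    \<comment> \<open>A constant \<open>p\<close> would be symmetric, so some neighbouring entries
      differ. A class \<open>S\<close> of size \<open>m\<close> with \<open>i\<close> but not
      \<open>j\<close> grows to size \<open>Suc m\<close> when \<open>j\<close> is flipped.\<close>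
    have "\<exists>m\<in>{1..<n}. p (Suc m) \<noteq> p m"
    proof (rule ccontr)
      assume *: "\<not> ?thesis"
      have const: "p (Suc m) = p 1" if "m < n" for m
        using that
      proof (induction m)
        case (Suc m)
        then have "p (Suc (Suc m)) = p (Suc m)" using * by auto
        with Suc show ?case by simp
      qed simp
      have "p (n + 1 - k) = p 1" using const[of "n - k"] k by (auto simp: Suc_diff_le)
      moreover have "p k = p 1" using const[of "k - 1"] k by auto
      ultimately show False using k by simp
    qed
    then obtain m where m: "m \<in> {1..<n}" "p (Suc m) \<noteq> p m" by blast
    have "m - 1 \<le> card ({1..n} - {i, j})" using m i j False by (auto simp: card_Diff_subset)
    then obtain T where T: "T \<subseteq> {1..n} - {i, j}" "card T = m - 1" "finite T"
      by (metis obtain_subset_with_card_n)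
    define S where "S = insert i T"
    have S: "S \<subseteq> {1..n}" "i \<in> S" "j \<notin> S" "finite S" "card S = m"
      using T i m False by (auto simp: S_def card_insert_if)
    have "{l \<in> {1..n}. ?x S l = ?x S i} = S"
      using S by auto
    moreover have "{l \<in> {1..n}. ((?x S)(j := 1 - ?x S j)) l = ((?x S)(j := 1 - ?x S j)) i} = insert j S"
      using S j False by auto
    ultimately have "pi_val n p i (?x S) \<noteq> pi_val n p i ((?x S)(j := 1 - ?x S j))"
      unfolding pi_val_def using m S by simp
    then show ?thesis using j by (intro bexI[of _ "?x S"]) auto
  qed
  then show "p \<in> Inf_set n" using p by (simp add: Inf_set_def)
qed

text \<open>Removing the constant \<open>c / 2\<close> leaves an odd vector with the same value of
  \<open>psi\<close>, and negative definiteness forces it to vanish.\<close>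

lemma psi_zero_imp_reversal_invariant:
  assumes "n \<ge> 2" "psi n p = 0" and sym: "\<And>k. k \<in> {1..n} \<Longrightarrow> p k + p (n + 1 - k) = c"
    and k: "k \<in> {1..n}"
  shows "p (n + 1 - k) = p k"
proof (rule ccontr)
  assume ne: "p (n + 1 - k) \<noteq> p k"
  define a where "a = (\<lambda>k. p k - c / 2)"
  have anti: "a (n + 1 - k) = - a k" if "k \<in> {1..n}" for k
    using sym[OF that] by (simp add: a_def)
  have "a k \<noteq> 0" using anti[OF k] ne by (auto simp: a_def)
  then have "psi n a < 0" using psi_antisym_neg[OF assms(1), of a] anti k by blast
  moreover have "psi n p = psi n a" using psi_affine[OF assms(1), of "c / 2" 1 a] by (simp add: a_def)
  ultimately show False using assms by simp
qed

section \<open>Explicit points over the sphere\<close>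

text \<open>
  Coordinates \<open>u\<^sub>0, \<dots>, u\<^sub>e\<close> of a point of a sphere, with \<open>e = (n - 3) div 2\<close>, become the values
  of an even vector at \<open>1, \<dots>, e + 1\<close>. Its value at the middle index \<open>e + 2\<close> is \<open>u\<^bsub>e+1\<^esub> = 0\<close>.
\<close>

definition fold_coord :: "nat \<Rightarrow> (nat \<Rightarrow> real) \<Rightarrow> nat \<Rightarrow> real" where
  "fold_coord n u k = u (min k (n + 1 - k) - 1)"

text \<open>Subtracting the weighted mean keeps differences of entries and makes the last partial
  sum zero, as \<open>odd_part_antisym\<close> requires.\<close>

definition even_part :: "nat \<Rightarrow> (nat \<Rightarrow> real) \<Rightarrow> nat \<Rightarrow> real" where
  "even_part n u k = fold_coord n u k - mean n (fold_coord n u)"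

text \<open>For \<open>psi n a < 0\<close> this is the larger root of the quadratic
  \<open>t \<mapsto> psi n (s + t a)\<close>; \<open>A\<close> is the negated leading
  coefficient.\<close>

definition root_factor :: "nat \<Rightarrow> (nat \<Rightarrow> real) \<Rightarrow> (nat \<Rightarrow> real) \<Rightarrow> real" where
  "root_factor n s a =
     (let A = - psi_form n a a; B = psi_form n s a + psi_form n a s; C = psi_form n s s
      in (B + sqrt (B\<^sup>2 + 4 * A * C)) / (2 * A))"

definition ray :: "nat \<Rightarrow> (nat \<Rightarrow> real) \<Rightarrow> nat \<Rightarrow> real" where
  "ray n u k = (let s = even_part n u; a = odd_part n s in s k + root_factor n s a * a k)"

text \<open>The sum bounds every entry of \<open>ray n u\<close>, so scaled entries have size at
  most 1/2; the summand 1 rules out a zero denominator.\<close>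

definition cube_scale :: "nat \<Rightarrow> (nat \<Rightarrow> real) \<Rightarrow> real" where
  "cube_scale n u = 1 / (2 * (1 + (\<Sum>j = 1..n. \<bar>ray n u j\<bar>)))"

definition cube_point :: "nat \<Rightarrow> (nat \<Rightarrow> real) \<Rightarrow> nat \<Rightarrow> real" where
  "cube_point n u k = 1 / 2 + cube_scale n u * ray n u k"

text \<open>Symmetrization removes the odd part, and subtracting the value at the middle index
  removes constants. Up to scale this recovers the sphere coordinates.\<close>

definition folded_diff :: "nat \<Rightarrow> (nat \<Rightarrow> real) \<Rightarrow> nat \<Rightarrow> real" where
  "folded_diff n p i = p (i + 1) + p (n - i) - (p ((n + 1) div 2) + p (n + 1 - (n + 1) div 2))"

lemma even_part_sym: "k \<in> {1..n} \<Longrightarrow> even_part n u (n + 1 - k) = even_part n u k"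
  by (auto simp: even_part_def fold_coord_def min.commute)

lemma mean_even_part: "n \<ge> 1 \<Longrightarrow> mean n (even_part n u) = 0"
proof -
  assume n: "n \<ge> 1"
  define c where "c = mean n (fold_coord n u)"
  have "mean n (even_part n u) = mean n (fold_coord n u) - mean n (\<lambda>k. c * 1)"
    by (simp add: mean_def even_part_def c_def right_diff_distrib sum_subtractf diff_divide_distrib)
  then show ?thesis unfolding mean_scale using n by (simp add: mean_one c_def)
qed

lemma odd_even_antisym:
  "k \<in> {1..n} \<Longrightarrow> odd_part n (even_part n u) (n + 1 - k) = - odd_part n (even_part n u) k"
  by (rule odd_part_antisym) (auto simp: even_part_sym mean_even_part simp del: One_nat_def)

lemma continuous_map_psi_form:
  assumes "\<And>k. continuous_map X euclideanreal (\<lambda>u. f u k)" "\<And>k. continuous_map X euclideanreal (\<lambda>u. g u k)"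
  shows "continuous_map X euclideanreal (\<lambda>u. psi_form n (f u) (g u))"
  unfolding psi_form_def mean_def cross_def divide_inverse
  by (intro continuous_intros assms) auto

lemma continuous_map_even_part:
  assumes "\<And>k. continuous_map X euclideanreal (\<lambda>u. u k)"
  shows "continuous_map X euclideanreal (\<lambda>u. even_part n u k)"
  unfolding even_part_def fold_coord_def mean_def divide_inverse
  by (intro continuous_intros assms) auto

lemma continuous_map_odd_part:
  assumes "\<And>k. continuous_map X euclideanreal (\<lambda>u. f u k)"
  shows "continuous_map X euclideanreal (\<lambda>u. odd_part n (f u) k)"
  unfolding odd_part_def partial_def divide_inverse
  by (intro continuous_intros assms) auto

section \<open>The section of the sphere into \<open>GST n\<close>\<close>

context
  fixes n e :: nat
  assumes n3: "n \<ge> 3" and e: "e = (n - 3) div 2"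
begin

lemma even_part_diff:
  assumes "i \<le> e" "u (e + 1) = 0"
  shows "even_part n u (i + 1) - even_part n u ((n + 1) div 2) = u i"
proof -
  \<comment> \<open>For either parity of \<open>n\<close> the middle index is \<open>e + 2\<close>,
    which folds to the coordinate \<open>e + 1\<close>, where \<open>u\<close> is zero.\<close>
  have h: "(n + 1) div 2 = e + 2" using n3 unfolding e by presburger
  then have "min (i + 1) (n + 1 - (i + 1)) - 1 = i"
    and "min ((n + 1) div 2) (n + 1 - (n + 1) div 2) - 1 = e + 1"
    using assms by auto
  then show ?thesis using assms by (simp add: even_part_def fold_coord_def)
qed

lemma even_part_nonzero:
  assumes "i \<le> e" "u (e + 1) = 0" "u i \<noteq> 0"
  shows "\<exists>k\<in>{1..n}. even_part n u k \<noteq> 0"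
proof -
  have "even_part n u (i + 1) \<noteq> 0 \<or> even_part n u ((n + 1) div 2) \<noteq> 0"
    using even_part_diff[of i u] assms by auto
  moreover have "i + 1 \<in> {1..n}" "(n + 1) div 2 \<in> {1..n}" using n3 e assms(1) by auto
  ultimately show ?thesis by blast
qed

lemma psi_odd_part_neg:
  assumes "i \<le> e" "u (e + 1) = 0" "u i \<noteq> 0"
  shows "psi n (odd_part n (even_part n u)) < 0"
proof -
  obtain k where "k \<in> {1..n}" "even_part n u k \<noteq> 0" using even_part_nonzero[of i u] assms by blast
  then obtain j where "j \<in> {1..n}" "odd_part n (even_part n u) j \<noteq> 0"
    using odd_part_nonzero[of k n "even_part n u"] by blast
  then show ?thesis
    using psi_antisym_neg[of n "odd_part n (even_part n u)" j] odd_even_antisym n3 by auto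
qed

lemma ray_root:
  assumes "i \<le> e" "u (e + 1) = 0" "u i \<noteq> 0"
  defines "s \<equiv> even_part n u"
  shows "root_factor n s (odd_part n s) > 0" "psi n (ray n u) = 0"
proof -
  define a where "a = odd_part n s"
  define A where "A = - psi n a"
  define B where "B = psi_form n s a + psi_form n a s"
  define C where "C = psi n s"
  have n: "n \<ge> 2" "n \<ge> 1" using n3 by auto
  have A: "A > 0" using psi_odd_part_neg[of i u] assms(1-3) by (simp add: A_def a_def s_def)
  obtain k where k: "k \<in> {1..n}" "s k \<noteq> 0" using even_part_nonzero[of i u] assms(1-3) by (auto simp: s_def)
  have "psi n (\<lambda>k. s k + a k) > 0"
    unfolding a_def
    using psi_even_plus_odd_pos[of n s k] n k even_part_sym[of _ n u] mean_even_part[of n u]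
    by (simp add: s_def)
  \<comment> \<open>The value of the pencil at 1 is positive; this is the inequality that
    \<open>larger_root\<close> asks for.\<close>
  then have ABC: "A < B + C"
    using psi_pencil[OF n(2), of s 1 a] by (simp add: A_def B_def C_def)
  have t: "root_factor n s a = (B + sqrt (B\<^sup>2 + 4 * A * C)) / (2 * A)"
    using n by (simp add: root_factor_def Let_def A_def B_def C_def psi_eq_form)
  show "root_factor n s (odd_part n s) > 0"
    using larger_root(1)[OF A ABC] by (simp add: t flip: a_def)
  have "psi n (ray n u) = psi n (\<lambda>k. s k + root_factor n s a * a k)"
    by (simp add: ray_def[abs_def] Let_def s_def a_def)
  also have "\<dots> = C + root_factor n s a * B - (root_factor n s a)\<^sup>2 * A"
    by (simp add: psi_pencil[OF n(2)] A_def B_def C_def)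
  finally show "psi n (ray n u) = 0"
    using larger_root(2)[OF A ABC] by (simp add: t)
qed

lemma cube_scale_denominator_pos: "0 < 2 * (1 + (\<Sum>j = 1..n. \<bar>ray n u j\<bar>))"
  by (intro mult_pos_pos add_pos_nonneg sum_nonneg) simp_all

lemma cube_scale_pos: "cube_scale n u > 0"
  unfolding cube_scale_def by (rule divide_pos_pos[OF zero_less_one cube_scale_denominator_pos])

lemma cube_point_bounds: "k \<in> {1..n} \<Longrightarrow> cube_point n u k \<in> {0..1}"
proof -
  assume k: "k \<in> {1..n}"
  define T where "T = (\<Sum>j = 1..n. \<bar>ray n u j\<bar>)"
  have "\<bar>ray n u k\<bar> \<le> T"
    unfolding T_def using k by (intro member_le_sum) auto
  moreover have "cube_scale n u = 1 / (2 * (1 + T))" by (simp add: cube_scale_def T_def)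
  moreover have "\<bar>r\<bar> \<le> T \<Longrightarrow> 1 / 2 + 1 / (2 * (1 + T)) * r \<in> {0..1}" for r :: real
    by (simp add: field_simps abs_le_iff)
  ultimately show ?thesis unfolding cube_point_def by metis
qed

lemma ray_rev:
  assumes "k \<in> {1..n}"
  shows "ray n u k + ray n u (n + 1 - k) = 2 * even_part n u k"
  using even_part_sym[OF assms] odd_even_antisym[OF assms] by (simp add: ray_def Let_def)

text \<open>The odd part cancels in the symmetrization and the centre \<open>1 / 2\<close> in the
  difference, so only the even part remains.\<close>

lemma folded_diff_cube_point:
  assumes "i \<le> e" "u (e + 1) = 0"
  shows "folded_diff n (restrict (cube_point n u) {1..n}) i = 2 * cube_scale n u * u i"
proof -
  have m: "i + 1 \<in> {1..n}" "n - i \<in> {1..n}" "(n + 1) div 2 \<in> {1..n}" "n + 1 - (n + 1) div 2 \<in> {1..n}"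
    using n3 e assms(1) by auto
  have "n - i = n + 1 - (i + 1)" by simp
  then have "ray n u (i + 1) + ray n u (n - i) = 2 * even_part n u (i + 1)"
    using ray_rev[OF m(1)] by metis
  moreover have "ray n u ((n + 1) div 2) + ray n u (n + 1 - (n + 1) div 2) = 2 * even_part n u ((n + 1) div 2)"
    using ray_rev[OF m(3)] by metis
  moreover have "folded_diff n (restrict (cube_point n u) {1..n}) i =
      cube_scale n u * ((ray n u (i + 1) + ray n u (n - i)) -
        (ray n u ((n + 1) div 2) + ray n u (n + 1 - (n + 1) div 2)))"
    unfolding folded_diff_def restrict_apply' [OF m(1)] restrict_apply' [OF m(2)]
      restrict_apply' [OF m(3)] restrict_apply' [OF m(4)] cube_point_def
    by (simp add: algebra_simps)
  moreover have "even_part n u (i + 1) - even_part n u ((n + 1) div 2) = u i"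
    using even_part_diff[of i u] assms .
  ultimately show ?thesis by (simp add: algebra_simps flip: distrib_left)
qed

lemma cube_point_in_GST:
  assumes "i \<le> e" "u (e + 1) = 0" "u i \<noteq> 0"
  shows "restrict (cube_point n u) {1..n} \<in> GST n"
proof -
  have n: "n \<ge> 2" using n3 by simp
  have mem: "restrict (cube_point n u) {1..n} \<in> {1..n} \<rightarrow>\<^sub>E {0..1}"
    using cube_point_bounds by auto
  have "psi n (restrict (cube_point n u) {1..n}) = psi n (\<lambda>k. 1 / 2 + cube_scale n u * ray n u k)"
    by (rule psi_cong[OF n]) (simp add: cube_point_def)
  also have "\<dots> = 0"
    using psi_affine[OF n] ray_root[of i u] assms by simp
  finally have Ind: "restrict (cube_point n u) {1..n} \<in> Ind n"
    using mem by (simp add: Ind_def)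
  obtain k where "k \<in> {1..n}" "even_part n u k \<noteq> 0" using even_part_nonzero[of i u] assms by blast
  then obtain j where j: "j \<in> {1..n}" "odd_part n (even_part n u) j \<noteq> 0"
    using odd_part_nonzero[of k n "even_part n u"] by blast
  have j': "n + 1 - j \<in> {1..n}" using j by auto
  \<comment> \<open>The two entries differ by twice the root factor times the odd part at
    \<open>j\<close>, up to sign, and the factor is positive.\<close>
  have "ray n u (n + 1 - j) \<noteq> ray n u j"
    using even_part_sym[OF j(1), of u] odd_even_antisym[OF j(1), of u] j(2) ray_root(1)[of i u] assms
    by (simp add: ray_def Let_def)
  then have "restrict (cube_point n u) {1..n} (n + 1 - j) \<noteq> restrict (cube_point n u) {1..n} j"
    unfolding restrict_apply'[OF j(1)] restrict_apply'[OF j'] cube_point_def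
    using cube_scale_pos[of u] by simp
  then have "restrict (cube_point n u) {1..n} \<in> Inf_set n"
    unfolding Inf_set_iff[OF n] using mem j(1) by blast
  with Ind show ?thesis by (simp add: GST_def)
qed

text \<open>Otherwise the symmetrization of \<open>p\<close> would be constant, and a zero of
  \<open>psi\<close> of this kind is reversal invariant, contrary to
  \<open>Inf_set n\<close>.\<close>

lemma folded_diff_nonzero:
  assumes "p \<in> GST n"
  shows "\<exists>i\<le>e. folded_diff n p i \<noteq> 0"
proof (rule ccontr)
  assume *: "\<not> ?thesis"
  have n: "n \<ge> 2" using n3 by simp
  define c where "c = p ((n + 1) div 2) + p (n + 1 - (n + 1) div 2)"
  have low: "p k + p (n + 1 - k) = c" if "k \<in> {1..e + 1}" for k
  proof -
    have "folded_diff n p (k - 1) = 0" using * that by auto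
    moreover have "k - 1 + 1 = k" "n - (k - 1) = n + 1 - k" using that by auto
    ultimately show ?thesis by (simp add: folded_diff_def c_def)
  qed
  have "p k + p (n + 1 - k) = c" if k: "k \<in> {1..n}" for k
  proof -
    \<comment> \<open>Every index is low, mirrors a low one, or is a middle one; for even
      \<open>n\<close> there are two middle indices, exchanged by the reversal.\<close>
    consider "k \<in> {1..e + 1}" | "n + 1 - k \<in> {1..e + 1}" | "k = (n + 1) div 2" | "n + 1 - k = (n + 1) div 2"
    proof -
      have "(n + 1) div 2 = e + 2" using n3 unfolding e by presburger
      moreover have "n + 1 = 2 * (e + 2) \<or> n + 1 = 2 * (e + 2) + 1" using n3 unfolding e by presburger
      ultimately show thesis using k that by fastforce
    qed
    then show ?thesis
    proof cases
      case 2
      then show ?thesis using low[OF 2] k by (simp add: add.commute)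
    next
      case 4
      then have "n + 1 - (n + 1) div 2 = k" using k by auto
      then show ?thesis using 4 by (simp add: c_def add.commute)
    qed (use low c_def in auto)
  qed
  moreover have "psi n p = 0" using assms by (simp add: GST_def Ind_def)
  ultimately have "\<forall>k\<in>{1..n}. p (n + 1 - k) = p k"
    using psi_zero_imp_reversal_invariant[OF n] by blast
  then show False using assms Inf_set_iff[OF n] by (auto simp: GST_def)
qed

section \<open>Continuity and the retraction onto the sphere\<close>

lemma topspace_nsphere_D:
  assumes "u \<in> topspace (nsphere e)"
  shows "(\<Sum>i\<le>e. (u i)\<^sup>2) = 1" "\<And>i. i > e \<Longrightarrow> u i = 0" "\<exists>i\<le>e. u i \<noteq> 0"
proof -
  show 1: "(\<Sum>i\<le>e. (u i)\<^sup>2) = 1" and "\<And>i. i > e \<Longrightarrow> u i = 0"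
    using assms by (auto simp: nsphere)
  show "\<exists>i\<le>e. u i \<noteq> 0"
  proof (rule ccontr)
    assume "\<not> ?thesis"
    then have "(\<Sum>i\<le>e. (u i)\<^sup>2) = 0" by simp
    with 1 show False by simp
  qed
qed

lemma continuous_map_ray: "continuous_map (nsphere e) euclideanreal (\<lambda>u. ray n u k)"
proof -
  have proj: "continuous_map (nsphere e) euclideanreal (\<lambda>u. u k)" for k
    unfolding nsphere by (intro continuous_map_from_subtopology continuous_map_product_projection) simp
  note ev = continuous_map_even_part[OF proj]
  note od = continuous_map_odd_part[OF ev]
  \<comment> \<open>The denominator of the root formula is nonzero, since some coordinate of
    \<open>u\<close> is nonzero and so \<open>psi\<close> is negative at the odd companion.\<close>
  have ne: "2 * - psi_form n (odd_part n (even_part n u)) (odd_part n (even_part n u)) \<noteq> 0"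
    if u: "u \<in> topspace (nsphere e)" for u
  proof -
    obtain i where "i \<le> e" "u i \<noteq> 0" using topspace_nsphere_D(3)[OF u] by blast
    moreover have "u (e + 1) = 0" using topspace_nsphere_D(2)[OF u] by simp
    ultimately have "psi n (odd_part n (even_part n u)) < 0" using psi_odd_part_neg by blast
    then show ?thesis using psi_eq_form[of n] n3 by simp
  qed
  show ?thesis
    unfolding ray_def root_factor_def Let_def
    by (intro continuous_intros ev od continuous_map_psi_form ne)
qed

lemma continuous_map_cube_point:
  "continuous_map (nsphere e) (subtopology (powertop_real {1..n}) (GST n))
     (\<lambda>u. restrict (cube_point n u) {1..n})"
proof (rule continuous_map_into_powertop_real_subset)
  fix k
  show "continuous_map (nsphere e) euclideanreal (\<lambda>u. cube_point n u k)"
    unfolding cube_point_def cube_scale_def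
    by (intro continuous_intros continuous_map_ray finite_atLeastAtMost
        cube_scale_denominator_pos[THEN less_imp_neq, symmetric]) simp
next
  fix u assume "u \<in> topspace (nsphere e)"
  then obtain i where "i \<le> e" "u i \<noteq> 0" "u (e + 1) = 0"
    using topspace_nsphere_D(2,3)[of u] less_add_one by blast
  then show "restrict (cube_point n u) {1..n} \<in> GST n"
    using cube_point_in_GST by blast
qed

text \<open>The value 0 beyond \<open>e\<close> is forced by \<open>nsphere e\<close>, whose points
  are functions on all of \<open>nat\<close> supported on \<open>0..e\<close>.\<close>

definition normalized_diff :: "(nat \<Rightarrow> real) \<Rightarrow> nat \<Rightarrow> real" where
  "normalized_diff p i =
     (if i < Suc e then folded_diff n p i / sqrt (\<Sum>j\<le>e. (folded_diff n p j)\<^sup>2) else 0)"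

lemma continuous_map_normalized_diff:
  "continuous_map (subtopology (powertop_real {1..n}) (GST n)) (nsphere e) normalized_diff"
proof -
  let ?X = "subtopology (powertop_real {1..n}) (GST n)"
  have proj: "continuous_map ?X euclideanreal (\<lambda>p. p k)" if "k \<in> {1..n}" for k
    using that by (intro continuous_map_from_subtopology continuous_map_product_projection)
  have fd: "continuous_map ?X euclideanreal (\<lambda>p. folded_diff n p i)" if "i \<le> e" for i
  proof -
    have "i + 1 \<in> {1..n}" "n - i \<in> {1..n}" "(n + 1) div 2 \<in> {1..n}" "n + 1 - (n + 1) div 2 \<in> {1..n}"
      using n3 e that by auto
    then show ?thesis
      unfolding folded_diff_def by (intro continuous_map_add continuous_map_diff proj)
  qed
  have pos: "(\<Sum>j\<le>e. (folded_diff n p j)\<^sup>2) > 0" if p: "p \<in> topspace ?X" for p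
  proof -
    obtain i where "i \<le> e" "folded_diff n p i \<noteq> 0" using folded_diff_nonzero[of p] p by auto
    then show ?thesis by (intro sum_pos2[where i = i]) auto
  qed
  have "continuous_map ?X euclideanreal (\<lambda>p. folded_diff n p i / sqrt (\<Sum>j\<le>e. (folded_diff n p j)\<^sup>2))"
    if "i \<le> e" for i
  proof (intro continuous_intros fd that)
    fix p assume "p \<in> topspace ?X"
    then show "sqrt (\<Sum>j\<le>e. (folded_diff n p j)\<^sup>2) \<noteq> 0" using pos[of p] by auto
  qed auto
  then have "continuous_map ?X (Euclidean_space (Suc e)) normalized_diff"
    unfolding normalized_diff_def[abs_def] continuous_map_componentwise_Euclidean_space by simp
  moreover have "(\<Sum>i\<le>e. (normalized_diff p i)\<^sup>2) = 1" if "p \<in> topspace ?X" for p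
    using pos[OF that]
    by (simp add: normalized_diff_def power_divide flip: sum_divide_distrib)
  ultimately show ?thesis
    unfolding nsphere_def continuous_map_in_subtopology by auto
qed

text \<open>On the image of the section the folded differences are one positive multiple
  \<open>M\<close> of \<open>u\<close>; normalizing removes \<open>M\<close> since \<open>u\<close>
  has norm 1.\<close>

lemma normalized_diff_cube_point:
  assumes "u \<in> topspace (nsphere e)"
  shows "normalized_diff (restrict (cube_point n u) {1..n}) = u"
proof
  fix i
  note u = topspace_nsphere_D[OF assms]
  let ?p = "restrict (cube_point n u) {1..n}"
  define M where "M = 2 * cube_scale n u"
  have M: "M > 0" using cube_scale_pos by (simp add: M_def)
  have fd: "folded_diff n ?p j = M * u j" if "j \<le> e" for j
    using folded_diff_cube_point[OF that] u(2)[of "e + 1"] by (simp add: M_def)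
  have "(\<Sum>j\<le>e. (folded_diff n ?p j)\<^sup>2) = (\<Sum>j\<le>e. M\<^sup>2 * (u j)\<^sup>2)"
    by (intro sum.cong refl) (simp only: atMost_iff fd power_mult_distrib)
  also have "\<dots> = M\<^sup>2" by (simp add: u flip: sum_distrib_left)
  finally show "normalized_diff ?p i = u i"
    using M fd u(2)[of i] by (auto simp: normalized_diff_def)
qed

lemma not_contractible_space_GST:
  "\<not> contractible_space (subtopology (powertop_real {1..n}) (GST n))"
proof
  let ?X = "subtopology (powertop_real {1..n}) (GST n)"
  assume "contractible_space ?X"
  moreover have "retraction_map ?X (nsphere e) normalized_diff"
    unfolding retraction_map_def retraction_maps_def
    using continuous_map_normalized_diff continuous_map_cube_point normalized_diff_cube_point by blast
  ultimately show False
    using contractible_space_retraction_map_image non_contractible_space_nsphere by blast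
qed

end

theorem proposition7p1:
  fixes n :: nat
  assumes "n \<ge> 3"
  shows "contractible_space (subtopology (powertop_real {1..n}) (Ind n)) \<and>
         \<not> contractible_space (subtopology (powertop_real {1..n}) (GST n))"
  using assms contractible_space_Ind not_contractible_space_GST by simp

end
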